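(* For any $x\in\mathbb{R}^n$, $s\in\mathcal{S}$ and $a\in\mathcal{A}$, $$\nabla V_s^*(x)=\mathbb{E}\Big[\sum_{t=0}^\infty\gamma^t\nabla r_{s_ta_t}(x)\ \Big|\ s_0=s,\ \pi^*(x)\Big],$$ $$\nabla Q_{sa}^*(x)=\mathbb{E}\Big[\sum_{t=0}^\infty\gamma^t\nabla r_{s_ta_t}(x)\ \Big|\ s_0=s,\ a_0=a,\ \pi^*(x)\Big].$$
   Context: Let $\mathcal{S},\mathcal{A}$ be finite nonempty sets, $P_{sas'}=P(s'|s,a)$ a transition kernel, $\gamma\in(0,1)$, $\tau>0$, and $r:\mathbb{R}^n\to\mathbb{R}^{|\mathcal{S}||\mathcal{A}|}$ a continuously differentiable parameterized reward with components $r_{sa}(x)$. A policy is $\pi=(\pi_s)_{s\in\mathcal{S}}$ with each $\pi_s=\pi(\cdot|s)$ a probability distribution on $\mathcal{A}$. With $h(\pi_s)=-\sum_a\pi_{sa}\log\pi_{sa}$ (convention $0\log0=0$), $V^\pi_s(x)=\mathbb{E}[\sum_{t\ge0}\gamma^t(r_{s_ta_t}(x)+\tau h(\pi_{s_t}))\mid s_0=s,\pi]$ and $Q^\pi_{sa}(x)=r_{sa}(x)+\gamma\sum_{s'}P_{sas'}V^\pi_{s'}(x)$. Let $\rho$ be a distribution on $\mathcal{S}$ with all entries positive; $\pi^*(x)$ is the unique maximizer over all policies of $\sum_s\rho_sV^\pi_s(x)$ (independent of $\rho$), $V^*(x)=V^{\pi^*(x)}(x)$, $Q^*(x)=Q^{\pi^*(x)}(x)$;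 $\nabla V^*_s(x)$, $\nabla Q^*_{sa}(x)$ are the gradients of the functions $x\mapsto V^*_s(x)$, $x\mapsto Q^*_{sa}(x)$. The expectations conditioned on "$\pi^*(x)$" are over trajectories $(s_0,a_0,s_1,a_1,\dots)$ with $a_t\sim\pi^*(x)(\cdot|s_t)$ (for $t\ge0$ in the first formula, $t\ge1$ in the second) and $s_{t+1}\sim P(\cdot|s_t,a_t)$; $x$ is held fixed inside the policy when taking $\nabla r$. *)

theory Defs
  imports "HOL-Probability.Probability"
begin

(* A policy is a function 's => 'a pmf, a transition kernel a function 's => 'a => 's pmf, and the
   reward at a fixed parameter a function 's => 'a => real. *)

definition sa_step :: "('s::finite \<Rightarrow> 'a::finite \<Rightarrow> 's pmf) \<Rightarrow> ('s \<Rightarrow> 'a pmf) \<Rightarrow> 's \<times> 'a \<Rightarrow> ('s \<times> 'a) pmf"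
  where "sa_step P \<pi> z = bind_pmf (P (fst z) (snd z)) (\<lambda>s'. map_pmf (\<lambda>a'. (s', a')) (\<pi> s'))"

definition sa_kernel ::
  "('s::finite \<Rightarrow> 'a::finite \<Rightarrow> 's pmf) \<Rightarrow> ('s \<Rightarrow> 'a pmf) \<Rightarrow> ('s \<times> 'a) pmf
    \<Rightarrow> nat \<Rightarrow> (nat \<Rightarrow> 's \<times> 'a) \<Rightarrow> ('s \<times> 'a) measure"
  where "sa_kernel P \<pi> \<mu> t \<omega> = measure_pmf (case t of 0 \<Rightarrow> \<mu> | Suc k \<Rightarrow> sa_step P \<pi> (\<omega> k))"

lemma Ionescu_Tulcea_sa_kernel:
  fixes P :: "'s::finite \<Rightarrow> 'a::finite \<Rightarrow> 's pmf"
  shows "Ionescu_Tulcea (sa_kernel P \<pi> \<mu>) (\<lambda>_. count_space UNIV)"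
proof (rule Ionescu_Tulcea.intro)
  fix i :: nat
  show "sa_kernel P \<pi> \<mu> i
      \<in> measurable (PiM {0..<i} (\<lambda>_. count_space UNIV)) (subprob_algebra (count_space UNIV))"
  proof (cases i)
    case 0
    then show ?thesis
      by (simp add: sa_kernel_def[abs_def] measure_pmf_in_subprob_algebra)
  next
    case (Suc k)
    have "(\<lambda>\<omega>. measure_pmf (sa_step P \<pi> (\<omega> k)))
        \<in> measurable (PiM {0..<Suc k} (\<lambda>_. count_space UNIV)) (subprob_algebra (count_space UNIV))"
      by (rule measurable_compose[OF measurable_component_singleton[where i = k]])
         (auto simp: measure_pmf_in_subprob_algebra)
    then show ?thesis
      by (simp add: Suc sa_kernel_def[abs_def])
  qed
next
  fix i :: nat and \<omega> :: "nat \<Rightarrow> 's \<times> 'a"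
  show "prob_space (sa_kernel P \<pi> \<mu> i \<omega>)"
    by (simp add: sa_kernel_def measure_pmf.prob_space_axioms)
qed

(* The law of the trajectory (s_0, a_0), (s_1, a_1), ... on infinite sequences, given by the
   Ionescu-Tulcea theorem: (s_0, a_0) has law \<mu>, and then s_{t+1} ~ P(.|s_t, a_t) and
   a_{t+1} ~ \<pi>(.|s_{t+1}). *)
definition trajectory ::
  "('s::finite \<Rightarrow> 'a::finite \<Rightarrow> 's pmf) \<Rightarrow> ('s \<Rightarrow> 'a pmf) \<Rightarrow> ('s \<times> 'a) pmf \<Rightarrow> (nat \<Rightarrow> 's \<times> 'a) measure"
  where "trajectory P \<pi> \<mu> =
    projective_family.lim UNIV (Ionescu_Tulcea.CI (sa_kernel P \<pi> \<mu>) (\<lambda>_. count_space UNIV))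
      (\<lambda>_. count_space UNIV)"

lemma sets_trajectory: "sets (trajectory P \<pi> \<mu>) = sets (PiM UNIV (\<lambda>_. count_space UNIV))"
proof -
  interpret Ionescu_Tulcea "sa_kernel P \<pi> \<mu>" "\<lambda>_. count_space UNIV"
    by (rule Ionescu_Tulcea_sa_kernel)
  show ?thesis
    by (simp add: trajectory_def)
qed

lemma emeasure_trajectory_cylinder:
  "emeasure (trajectory P \<pi> \<mu>) {\<omega>. \<forall>i\<le>n. \<omega> i = z i} =
    ennreal (pmf \<mu> (z 0) * (\<Prod>i<n. pmf (sa_step P \<pi> (z i)) (z (Suc i))))"
proof -
  let ?M = "\<lambda>_::nat. count_space UNIV"
  interpret Ionescu_Tulcea "sa_kernel P \<pi> \<mu>" ?M
    by (rule Ionescu_Tulcea_sa_kernel)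
  let ?z = "\<lambda>n. restrict z {0..<n}"
  have sing: "{?z n} \<in> sets (PiM {0..<n} ?M)" for n
  proof -
    have "{?z n} = PiE {0..<n} (\<lambda>i. {z i})"
      by (auto simp: PiE_iff extensional_def fun_eq_iff)
    then show ?thesis
      by (simp add: sets_PiM_I_finite)
  qed
  have sp: "?z n \<in> space (PiM {0..<n} ?M)" for n
    by (simp add: space_PiM)
  define c where "c = (\<lambda>n. emeasure (C 0 n (\<lambda>_. undefined)) {?z n})"
  have rec: "c (Suc n) = emeasure (sa_kernel P \<pi> \<mu> n (?z n)) {z n} * c n" for n
  proof -
    have eP: "emeasure (eP n \<omega>) {?z (Suc n)} = emeasure (sa_kernel P \<pi> \<mu> n (?z n)) {z n} * indicator {?z n} \<omega>"
      if \<omega>: "\<omega> \<in> space (PiM {0..<n} ?M)" for \<omega>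
    proof -
      have ext: "\<omega> \<in> extensional {0..<n}"
        using \<omega> by (simp add: space_PiM PiE_iff)
      have "(\<lambda>x. fun_upd \<omega> n x) -` {?z (Suc n)} \<inter> UNIV = (if \<omega> = ?z n then {z n} else {})"
      proof (cases "\<omega> = ?z n")
        case True
        have "fun_upd (?z n) n x = ?z (Suc n) \<longleftrightarrow> x = z n" for x
        proof
          assume "fun_upd (?z n) n x = ?z (Suc n)"
          from fun_cong[OF this, of n] show "x = z n"
            by simp
        qed (auto simp: fun_eq_iff less_Suc_eq)
        with True show ?thesis
          by auto
      next
        case False
        have "fun_upd \<omega> n x \<noteq> ?z (Suc n)" for x
        proof
          assume eq: "fun_upd \<omega> n x = ?z (Suc n)"
          have "\<omega> i = ?z n i" for i
            using fun_cong[OF eq, of i] ext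
            by (cases "i < n") (auto simp: extensional_def restrict_def split: if_splits)
          with False show False by auto
        qed
        then show ?thesis
          using False by auto
      qed
      then show ?thesis
        using emeasure_eP[OF \<omega> sing[of "Suc n"]] by (simp add: indicator_def)
    qed
    have "c (Suc n) = (\<integral>\<^sup>+\<omega>. emeasure (eP n \<omega>) {?z (Suc n)} \<partial>C 0 n (\<lambda>_. undefined))"
      unfolding c_def C.simps add_0
      by (rule emeasure_bind[where N = "PiM {0..<Suc n} ?M"])
         (use measurable_eP[of n] sing[of "Suc n"] in
           \<open>auto simp: space_C space_PiM measurable_cong_sets[OF sets_C[of "\<lambda>_. undefined" 0 n, simplified] refl]\<close>)
    also have "\<dots> = (\<integral>\<^sup>+\<omega>. emeasure (sa_kernel P \<pi> \<mu> n (?z n)) {z n} * indicator {?z n} \<omega> \<partial>C 0 n (\<lambda>_. undefined))"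
      by (rule nn_integral_cong) (simp add: eP space_C[of "\<lambda>_. undefined" 0 n, simplified])
    also have "\<dots> = emeasure (sa_kernel P \<pi> \<mu> n (?z n)) {z n} * c n"
      unfolding c_def
      by (rule nn_integral_cmult_indicator) (use sing[of n] in \<open>simp add: sets_C[of "\<lambda>_. undefined" 0 n, simplified]\<close>)
    finally show ?thesis .
  qed
  have c0: "c 0 = 1"
    by (simp add: c_def restrict_def PiM_empty indicator_def)
  have cS: "c (Suc n) = ennreal (pmf \<mu> (z 0) * (\<Prod>i<n. pmf (sa_step P \<pi> (z i)) (z (Suc i))))" for n
  proof (induction n)
    case 0
    show ?case
      by (simp add: rec[of 0] c0 sa_kernel_def emeasure_pmf_single)
  next
    case (Suc n)
    show ?case
      by (simp add: rec[of "Suc n"] Suc sa_kernel_def emeasure_pmf_single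
            ennreal_mult'[symmetric] prod_nonneg mult_ac)
  qed
  have cyl: "{\<omega>. \<forall>i\<le>n. \<omega> i = z i} = PF.emb UNIV {0..<Suc n} {?z (Suc n)}"
    by (auto simp: prod_emb_def fun_eq_iff less_Suc_eq_le restrict_def split: if_splits)
  have "emeasure (trajectory P \<pi> \<mu>) {\<omega>. \<forall>i\<le>n. \<omega> i = z i} = emeasure (CI {0..<Suc n}) {?z (Suc n)}"
    unfolding trajectory_def cyl by (rule lim) (use sing in auto)
  also have "\<dots> = c (Suc n)"
  proof -
    have "PF.emb {0..<Suc n} {0..<Suc n} {?z (Suc n)} = {?z (Suc n)}"
      by (rule prod_emb_id) (auto simp: space_PiM)
    then show ?thesis
      using emeasure_CI[of "{0..<Suc n}" "Suc n" "{?z (Suc n)}"] sing[of "Suc n"]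
      by (simp add: c_def del: C.simps)
  qed
  finally show ?thesis
    by (simp add: cS)
qed

(* 0 log 0 = 0 holds since the factor pmf p a vanishes. *)
definition policy_entropy :: "'a::finite pmf \<Rightarrow> real"
  where "policy_entropy p = - (\<Sum>a\<in>UNIV. pmf p a * ln (pmf p a))"

definition value_fn ::
  "('s::finite \<Rightarrow> 'a::finite \<Rightarrow> 's pmf) \<Rightarrow> real \<Rightarrow> real \<Rightarrow> ('s \<Rightarrow> 'a \<Rightarrow> real) \<Rightarrow> ('s \<Rightarrow> 'a pmf) \<Rightarrow> 's \<Rightarrow> real"
  where "value_fn P \<gamma> \<tau> r \<pi> s =
    (\<integral>\<omega>. (\<Sum>t. \<gamma> ^ t * (r (fst (\<omega> t)) (snd (\<omega> t)) + \<tau> * policy_entropy (\<pi> (fst (\<omega> t)))))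
      \<partial>trajectory P \<pi> (map_pmf (\<lambda>a. (s, a)) (\<pi> s)))"

definition q_fn ::
  "('s::finite \<Rightarrow> 'a::finite \<Rightarrow> 's pmf) \<Rightarrow> real \<Rightarrow> real \<Rightarrow> ('s \<Rightarrow> 'a \<Rightarrow> real) \<Rightarrow> ('s \<Rightarrow> 'a pmf) \<Rightarrow> 's \<Rightarrow> 'a \<Rightarrow> real"
  where "q_fn P \<gamma> \<tau> r \<pi> s a =
    r s a + \<gamma> * (\<Sum>s'\<in>UNIV. pmf (P s a) s' * value_fn P \<gamma> \<tau> r \<pi> s')"

definition optimal_policy ::
  "('s::finite \<Rightarrow> 'a::finite \<Rightarrow> 's pmf) \<Rightarrow> real \<Rightarrow> real \<Rightarrow> 's pmf \<Rightarrow> ('s \<Rightarrow> 'a \<Rightarrow> real) \<Rightarrow> 's \<Rightarrow> 'a pmf"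
  where "optimal_policy P \<gamma> \<tau> \<rho> r =
    (THE \<pi>. is_arg_max (\<lambda>\<pi>. \<Sum>s\<in>UNIV. pmf \<rho> s * value_fn P \<gamma> \<tau> r \<pi> s) (\<lambda>_. True) \<pi>)"

definition optimal_value ::
  "('s::finite \<Rightarrow> 'a::finite \<Rightarrow> 's pmf) \<Rightarrow> real \<Rightarrow> real \<Rightarrow> 's pmf \<Rightarrow> ('s \<Rightarrow> 'a \<Rightarrow> real) \<Rightarrow> 's \<Rightarrow> real"
  where "optimal_value P \<gamma> \<tau> \<rho> r = value_fn P \<gamma> \<tau> r (optimal_policy P \<gamma> \<tau> \<rho> r)"

definition optimal_q ::
  "('s::finite \<Rightarrow> 'a::finite \<Rightarrow> 's pmf) \<Rightarrow> real \<Rightarrow> real \<Rightarrow> 's pmf \<Rightarrow> ('s \<Rightarrow> 'a \<Rightarrow> real) \<Rightarrow> 's \<Rightarrow> 'a \<Rightarrow> real"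
  where "optimal_q P \<gamma> \<tau> \<rho> r = q_fn P \<gamma> \<tau> r (optimal_policy P \<gamma> \<tau> \<rho> r)"

end

theory Submission
  imports Defs
begin

text \<open>
  By Gibbs' variational principle, \<open>\<tau> log \<Sum>\<^sub>a exp (q\<^sub>a / \<tau>)\<close> is the maximum of
  \<open>\<Sum>\<^sub>a p\<^sub>a q\<^sub>a + \<tau> h(p)\<close> over distributions \<open>p\<close>, attained only at the softmax of \<open>q\<close>. Hence
  \<open>V\<^sup>*\<close> is the fixed point of the soft Bellman operator and \<open>\<pi>\<^sup>*\<close> is the softmax of \<open>Q\<^sup>* / \<tau>\<close>.
  The gradient of log-sum-exp is the softmax, so expanding the soft Bellman equation to first order
  gives the linear Bellman equation of \<open>\<pi>\<^sup>*(x)\<close> with reward \<open>\<nabla>r\<close> up to an error \<open>o(\<bar>y - x\<bar>)\<close>, which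
  the discount amplifies by at most \<open>1 / (1 - \<gamma>)\<close>. The expected discounted sum of \<open>\<nabla>r\<close> along
  trajectories solves the same linear equation.
\<close>

subsection \<open>Discounted sums along trajectories\<close>

text \<open>The cylinder over the empty index set is the whole space, so its mass is the total mass
  of the projective family at \<open>{}\<close>, which is 1.\<close>

lemma prob_space_trajectory: "prob_space (trajectory P \<pi> \<mu>)"
proof -
  interpret Ionescu_Tulcea "sa_kernel P \<pi> \<mu>" "\<lambda>_. count_space UNIV"
    by (rule Ionescu_Tulcea_sa_kernel)
  have "emeasure (trajectory P \<pi> \<mu>) (PF.emb UNIV {} {\<lambda>_. undefined}) = emeasure (CI {}) {\<lambda>_. undefined}"
    unfolding trajectory_def by (rule lim) (auto simp: PiM_empty)
  also have "\<dots> = 1"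
    using prob_space.emeasure_space_1[OF PF.prob_space_P[of "{}"]]
    by (simp add: PF.space_P space_PiM)
  finally have "emeasure (trajectory P \<pi> \<mu>) (space (trajectory P \<pi> \<mu>)) = 1"
    using sets_eq_imp_space_eq[OF sets_trajectory[of P \<pi> \<mu>]]
    by (simp add: prod_emb_def space_PiM vimage_def restrict_def)
  then show ?thesis
    by (rule prob_spaceI)
qed

lemma space_trajectory [simp]: "space (trajectory P \<pi> \<mu>) = UNIV"
  using sets_eq_imp_space_eq[OF sets_trajectory[of P \<pi> \<mu>]] by (simp add: space_PiM)

lemma measurable_trajectory_component [measurable]:
  "(\<lambda>\<omega>. \<omega> t) \<in> measurable (trajectory P \<pi> \<mu>) (count_space UNIV)"
  by (subst measurable_cong_sets[OF sets_trajectory refl]) (rule measurable_component_singleton, simp)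

text \<open>The marginals as a Markov chain on the finite set of state-action pairs:
  \<open>measure_trajectory_component\<close> identifies them as the laws of
  \<open>\<omega> t\<close>, which turns expectations into finite sums.\<close>

definition trajectory_law ::
  "('s::finite \<Rightarrow> 'a::finite \<Rightarrow> 's pmf) \<Rightarrow> ('s \<Rightarrow> 'a pmf) \<Rightarrow> ('s \<times> 'a) pmf \<Rightarrow> nat \<Rightarrow> ('s \<times> 'a) pmf"
  where "trajectory_law P \<pi> \<mu> t = ((\<lambda>\<nu>. bind_pmf \<nu> (sa_step P \<pi>)) ^^ t) \<mu>"

lemma trajectory_law_0 [simp]: "trajectory_law P \<pi> \<mu> 0 = \<mu>"
  by (simp add: trajectory_law_def)

lemma trajectory_law_Suc:
  "trajectory_law P \<pi> \<mu> (Suc t) = bind_pmf (trajectory_law P \<pi> \<mu> t) (sa_step P \<pi>)"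
  by (simp add: trajectory_law_def)

text \<open>Splitting off the first transition instead of the last is what produces the Bellman
  recursion later.\<close>

lemma trajectory_law_Suc_shift:
  "trajectory_law P \<pi> \<mu> (Suc t) = trajectory_law P \<pi> (bind_pmf \<mu> (sa_step P \<pi>)) t"
  by (simp add: trajectory_law_def funpow_Suc_right del: funpow.simps)

lemma trajectory_law_bind:
  "trajectory_law P \<pi> (bind_pmf \<mu> g) t = bind_pmf \<mu> (\<lambda>z. trajectory_law P \<pi> (g z) t)"
  by (induction t) (simp_all add: trajectory_law_Suc bind_assoc_pmf)

lemma pmf_bind_finite:
  fixes p :: "'a::finite pmf"
  shows "pmf (bind_pmf p g) i = (\<Sum>z\<in>UNIV. pmf p z * pmf (g z) i)"
  by (simp add: pmf_bind integral_measure_pmf[of UNIV])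

text \<open>Only cylinder probabilities are available, so the event at time \<open>t\<close> is
  partitioned into the finitely many cylinders given by the first coordinates. The last factor of
  the cylinder formula is the transition probability, which drives the induction.\<close>

lemma measure_trajectory_component:
  "measure (trajectory P \<pi> \<mu>) {\<omega>. \<omega> t = v} = pmf (trajectory_law P \<pi> \<mu> t) v"
proof (induction t arbitrary: v)
  case 0
  have "{\<omega>. \<omega> 0 = v} = {\<omega>. \<forall>i\<le>(0::nat). \<omega> i = v}"
    by auto
  then show ?case
    using emeasure_trajectory_cylinder[of P \<pi> \<mu> 0 "\<lambda>_. v"] by (simp add: measure_def)
next
  case (Suc t)
  let ?M = "trajectory P \<pi> \<mu>"
  interpret prob_space ?M
    by (rule prob_space_trajectory)
  define cyl where "cyl n z = {\<omega>. \<forall>i\<le>n. \<omega> i = z i}" for n :: nat and z :: "nat \<Rightarrow> 'a \<times> 'b"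
  \<comment> \<open>Functions in \<open>Z\<close> are \<open>undefined\<close> beyond
    \<open>t\<close>, so every prefix has exactly one representative. This makes \<open>Z\<close>
    finite and its cylinders disjoint.\<close>
  define Z where "Z = PiE {..t} (\<lambda>_. UNIV :: ('a \<times> 'b) set)"
  have finZ: "finite Z"
    unfolding Z_def by (intro finite_PiE) auto
  have cyl_sets: "cyl n z \<in> sets ?M" for n z
  proof -
    have "cyl n z = (\<Inter>i\<in>{..n}. (\<lambda>\<omega>. \<omega> i) -` {z i} \<inter> space ?M)"
      by (auto simp: cyl_def)
    also have "\<dots> \<in> sets ?M"
      by (intro sets.finite_INT measurable_sets[OF measurable_trajectory_component]) auto
    finally show ?thesis .
  qed
  have unique: "z = z'" if "z \<in> Z" "z' \<in> Z" "\<And>i. i \<le> t \<Longrightarrow> z i = z' i" for z z'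
    using that by (auto simp: Z_def intro!: PiE_ext)
  have "disjoint_family_on (cyl t) Z"
    unfolding disjoint_family_on_def
  proof (intro ballI impI)
    fix z z' assume "z \<in> Z" "z' \<in> Z" "z \<noteq> z'"
    then show "cyl t z \<inter> cyl t z' = {}"
      using unique[of z z'] by (auto simp: cyl_def)
  qed
  have prefix: "restrict \<omega> {..t} \<in> Z" "\<omega> \<in> cyl t (restrict \<omega> {..t})" for \<omega>
    by (auto simp: Z_def cyl_def)
  have meas_t: "measure ?M {\<omega>. \<omega> t = u} = (\<Sum>z\<in>{z\<in>Z. z t = u}. measure ?M (cyl t z))" for u
  proof -
    have "{\<omega>. \<omega> t = u} = (\<Union>z\<in>{z\<in>Z. z t = u}. cyl t z)"
    proof (intro equalityI subsetI)
      fix \<omega> assume "\<omega> \<in> {\<omega>. \<omega> t = u}"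
      then show "\<omega> \<in> (\<Union>z\<in>{z\<in>Z. z t = u}. cyl t z)"
        by (intro UN_I[of "restrict \<omega> {..t}"]) (use prefix[of \<omega>] in auto)
    qed (auto simp: cyl_def)
    moreover have "disjoint_family_on (cyl t) {z\<in>Z. z t = u}"
      by (rule disjoint_family_on_mono[OF _ \<open>disjoint_family_on (cyl t) Z\<close>]) simp
    moreover have "measure ?M (\<Union>z\<in>{z\<in>Z. z t = u}. cyl t z) = (\<Sum>z\<in>{z\<in>Z. z t = u}. measure ?M (cyl t z))"
      if "disjoint_family_on (cyl t) {z\<in>Z. z t = u}"
      by (rule finite_measure_finite_Union[OF _ _ that]) (use finZ cyl_sets in auto)
    ultimately show ?thesis
      by (metis (no_types))
  qed
  have meas_Suc: "measure ?M {\<omega>. \<omega> (Suc t) = v} = (\<Sum>z\<in>Z. measure ?M (cyl (Suc t) (z(Suc t := v))))"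
  proof -
    have "{\<omega>. \<omega> (Suc t) = v} = (\<Union>z\<in>Z. cyl (Suc t) (z(Suc t := v)))"
    proof (intro equalityI subsetI)
      fix \<omega> assume "\<omega> \<in> {\<omega>. \<omega> (Suc t) = v}"
      then show "\<omega> \<in> (\<Union>z\<in>Z. cyl (Suc t) (z(Suc t := v)))"
        by (intro UN_I[of "restrict \<omega> {..t}"]) (use prefix[of \<omega>] in \<open>auto simp: cyl_def\<close>)
    qed (auto simp: cyl_def)
    moreover have "disjoint_family_on (\<lambda>z. cyl (Suc t) (z(Suc t := v))) Z"
    proof -
      have "cyl (Suc t) (z(Suc t := v)) \<subseteq> cyl t z" for z
        by (auto simp: cyl_def)
      with disjoint_family_onD[OF \<open>disjoint_family_on (cyl t) Z\<close>] show ?thesis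
        unfolding disjoint_family_on_def by (metis (no_types, lifting) Int_mono subset_empty)
    qed
    moreover have "measure ?M (\<Union>z\<in>Z. cyl (Suc t) (z(Suc t := v))) = (\<Sum>z\<in>Z. measure ?M (cyl (Suc t) (z(Suc t := v))))"
      if "disjoint_family_on (\<lambda>z. cyl (Suc t) (z(Suc t := v))) Z"
      by (rule finite_measure_finite_Union[OF _ _ that]) (use finZ cyl_sets in auto)
    ultimately show ?thesis
      by (metis (no_types))
  qed
  have step: "measure ?M (cyl (Suc t) (z(Suc t := v))) = measure ?M (cyl t z) * pmf (sa_step P \<pi> (z t)) v" for z
    unfolding cyl_def measure_def emeasure_trajectory_cylinder
    by (simp add: prod_nonneg)
  have "measure ?M {\<omega>. \<omega> (Suc t) = v} = (\<Sum>z\<in>Z. measure ?M (cyl t z) * pmf (sa_step P \<pi> (z t)) v)"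
    by (simp add: meas_Suc step)
  \<comment> \<open>The Markov property: the transition factor depends on a prefix only through its
    last entry \<open>u\<close>, so prefixes are grouped by \<open>u\<close>.\<close>
  also have "\<dots> = (\<Sum>u\<in>UNIV. \<Sum>z\<in>{z\<in>Z. z t = u}. measure ?M (cyl t z) * pmf (sa_step P \<pi> (z t)) v)"
    by (rule sum.group[symmetric]) (use finZ in auto)
  also have "\<dots> = (\<Sum>u\<in>UNIV. measure ?M {\<omega>. \<omega> t = u} * pmf (sa_step P \<pi> u) v)"
    by (simp add: meas_t sum_distrib_right)
  also have "\<dots> = pmf (trajectory_law P \<pi> \<mu> (Suc t)) v"
    by (simp add: Suc.IH trajectory_law_Suc pmf_bind_finite)
  finally show ?case .
qed

lemma sum_indicator_scaleR:
  fixes f :: "'b::finite \<Rightarrow> 'e::real_vector"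
  shows "(\<Sum>z\<in>UNIV. indicator {\<omega>. g \<omega> = z} w *\<^sub>R f z) = f (g w)"
proof -
  have "(\<Sum>z\<in>UNIV. indicator {\<omega>. g \<omega> = z} w *\<^sub>R f z) = (\<Sum>z\<in>UNIV. if g w = z then f z else 0)"
    by (rule sum.cong) auto
  then show ?thesis
    by simp
qed

lemma integral_trajectory_component:
  fixes f :: "'s::finite \<times> 'a::finite \<Rightarrow> 'e::{banach, second_countable_topology}"
  shows "(\<integral>\<omega>. f (\<omega> t) \<partial>trajectory P \<pi> \<mu>) = (\<Sum>z\<in>UNIV. pmf (trajectory_law P \<pi> \<mu> t) z *\<^sub>R f z)"
proof -
  let ?M = "trajectory P \<pi> \<mu>"
  interpret prob_space ?M
    by (rule prob_space_trajectory)
  have sets [simp]: "{\<omega>. \<omega> t = z} \<in> sets ?M" for z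
    using measurable_sets[OF measurable_trajectory_component[of t P \<pi> \<mu>], of "{z}"]
    by (simp add: vimage_def)
  have "(\<integral>\<omega>. f (\<omega> t) \<partial>?M) = (\<integral>\<omega>. (\<Sum>z\<in>UNIV. indicator {\<omega>. \<omega> t = z} \<omega> *\<^sub>R f z) \<partial>?M)"
    by (simp only: sum_indicator_scaleR)
  also have "\<dots> = (\<Sum>z\<in>UNIV. measure ?M {\<omega>. \<omega> t = z} *\<^sub>R f z)"
    by (subst Bochner_Integration.integral_sum)
       (auto simp: emeasure_eq_measure)
  finally show ?thesis
    by (simp add: measure_trajectory_component)
qed

lemma sum_pmf_return:
  fixes f :: "'b::finite \<Rightarrow> 'e::{banach, second_countable_topology}"
  shows "(\<Sum>w\<in>UNIV. pmf (return_pmf z) w *\<^sub>R f w) = f z"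
  using integral_measure_pmf[of UNIV "return_pmf z" f] by simp

text \<open>The values lie in a Banach space because the same functional is needed for the real
  entropy-regularized reward and for the vector-valued gradient of the reward.\<close>

definition discounted ::
  "('s::finite \<Rightarrow> 'a::finite \<Rightarrow> 's pmf) \<Rightarrow> ('s \<Rightarrow> 'a pmf) \<Rightarrow> real
    \<Rightarrow> ('s \<times> 'a \<Rightarrow> 'e::{banach, second_countable_topology}) \<Rightarrow> ('s \<times> 'a) pmf \<Rightarrow> 'e"
  where "discounted P \<pi> \<gamma> f \<mu> = (\<integral>\<omega>. (\<Sum>t. \<gamma> ^ t *\<^sub>R f (\<omega> t)) \<partial>trajectory P \<pi> \<mu>)"

context
  fixes P :: "'s::finite \<Rightarrow> 'a::finite \<Rightarrow> 's pmf" and \<pi> :: "'s \<Rightarrow> 'a pmf"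
    and \<gamma> :: real and f :: "'s \<times> 'a \<Rightarrow> 'e::{banach, second_countable_topology}"
  assumes gamma: "0 \<le> \<gamma>" "\<gamma> < 1"
begin

text \<open>Since \<open>f\<close> has finite domain it is bounded, so a geometric series dominates
  the sum and expectation and summation may be exchanged.\<close>

lemma discounted_sums:
  "(\<lambda>t. \<gamma> ^ t *\<^sub>R (\<Sum>z\<in>UNIV. pmf (trajectory_law P \<pi> \<mu> t) z *\<^sub>R f z)) sums discounted P \<pi> \<gamma> f \<mu>"
proof -
  let ?M = "trajectory P \<pi> \<mu>"
  interpret prob_space ?M
    by (rule prob_space_trajectory)
  obtain B where B: "\<And>z. norm (f z) \<le> B"
    using bounded_iff[of "range f"] finite_imp_bounded[of "range f"] by auto
  have meas: "(\<lambda>\<omega>. f (\<omega> t)) \<in> borel_measurable ?M" for t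
    by (rule measurable_compose[OF measurable_trajectory_component]) simp
  have int: "integrable ?M (\<lambda>\<omega>. f (\<omega> t))" for t
    by (rule integrable_const_bound[of _ B]) (use B meas in auto)
  have geo: "summable (\<lambda>t. \<gamma> ^ t * B)"
    using gamma by (intro summable_mult2 summable_geometric) auto
  have "(\<lambda>t. \<integral>\<omega>. \<gamma> ^ t *\<^sub>R f (\<omega> t) \<partial>?M) sums (\<integral>\<omega>. (\<Sum>t. \<gamma> ^ t *\<^sub>R f (\<omega> t)) \<partial>?M)"
  proof (rule sums_integral)
    show "integrable ?M (\<lambda>\<omega>. \<gamma> ^ t *\<^sub>R f (\<omega> t))" for t
      using int by simp
    have *: "norm (\<gamma> ^ t *\<^sub>R f z) \<le> \<gamma> ^ t * B" for t z
      using gamma B by (simp add: mult_left_mono)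
    show "AE \<omega> in ?M. summable (\<lambda>t. norm (\<gamma> ^ t *\<^sub>R f (\<omega> t)))"
    proof (rule AE_I2)
      fix \<omega>
      show "summable (\<lambda>t. norm (\<gamma> ^ t *\<^sub>R f (\<omega> t)))"
        by (rule summable_comparison_test'[OF geo, of 0]) (use * in auto)
    qed
    show "summable (\<lambda>t. \<integral>\<omega>. norm (\<gamma> ^ t *\<^sub>R f (\<omega> t)) \<partial>?M)"
    proof (rule summable_comparison_test'[OF geo, of 0])
      fix t :: nat
      have "(\<integral>\<omega>. norm (\<gamma> ^ t *\<^sub>R f (\<omega> t)) \<partial>?M) \<le> (\<integral>\<omega>. \<gamma> ^ t * B \<partial>?M)"
        using int by (intro integral_mono *) auto
      moreover have "0 \<le> (\<integral>\<omega>. norm (\<gamma> ^ t *\<^sub>R f (\<omega> t)) \<partial>?M)"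
        by (rule integral_nonneg_AE) auto
      moreover have "(\<integral>\<omega>. \<gamma> ^ t * B \<partial>?M) = \<gamma> ^ t * B"
        using prob_space by simp
      ultimately show "norm (\<integral>\<omega>. norm (\<gamma> ^ t *\<^sub>R f (\<omega> t)) \<partial>?M) \<le> \<gamma> ^ t * B"
        unfolding real_norm_def by linarith
    qed
  qed
  then show ?thesis
    by (simp only: discounted_def integral_scaleR_right integral_trajectory_component[where f = f])
qed

lemma discounted_bind:
  fixes \<mu> :: "'b::finite pmf"
  shows "discounted P \<pi> \<gamma> f (bind_pmf \<mu> g) = (\<Sum>i\<in>UNIV. pmf \<mu> i *\<^sub>R discounted P \<pi> \<gamma> f (g i))"
proof (rule sums_unique2[OF discounted_sums])
  have "\<gamma> ^ t *\<^sub>R (\<Sum>z\<in>UNIV. pmf (trajectory_law P \<pi> (bind_pmf \<mu> g) t) z *\<^sub>R f z)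
      = (\<Sum>i\<in>UNIV. pmf \<mu> i *\<^sub>R (\<gamma> ^ t *\<^sub>R (\<Sum>z\<in>UNIV. pmf (trajectory_law P \<pi> (g i) t) z *\<^sub>R f z)))" for t
  proof -
    have "(\<Sum>z\<in>UNIV. pmf (trajectory_law P \<pi> (bind_pmf \<mu> g) t) z *\<^sub>R f z)
        = (\<Sum>z\<in>UNIV. \<Sum>i\<in>UNIV. pmf \<mu> i *\<^sub>R (pmf (trajectory_law P \<pi> (g i) t) z *\<^sub>R f z))"
      by (simp add: trajectory_law_bind pmf_bind_finite scaleR_sum_left)
    also have "\<dots> = (\<Sum>i\<in>UNIV. pmf \<mu> i *\<^sub>R (\<Sum>z\<in>UNIV. pmf (trajectory_law P \<pi> (g i) t) z *\<^sub>R f z))"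
      unfolding scaleR_sum_right by (rule sum.swap)
    finally show ?thesis
      by (simp add: scaleR_sum_right mult.left_commute)
  qed
  then show "(\<lambda>t. \<gamma> ^ t *\<^sub>R (\<Sum>z\<in>UNIV. pmf (trajectory_law P \<pi> (bind_pmf \<mu> g) t) z *\<^sub>R f z))
      sums (\<Sum>i\<in>UNIV. pmf \<mu> i *\<^sub>R discounted P \<pi> \<gamma> f (g i))"
    by (simp only:) (intro sums_sum sums_scaleR_right discounted_sums)
qed

text \<open>The term at time 0 is \<open>f z\<close>; the remaining terms carry a common factor
  \<gamma> and belong to the chain restarted from the law after one transition.\<close>

lemma discounted_return:
  "discounted P \<pi> \<gamma> f (return_pmf z) = f z + \<gamma> *\<^sub>R discounted P \<pi> \<gamma> f (sa_step P \<pi> z)"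
proof (rule sums_unique2[OF discounted_sums])
  let ?c = "\<lambda>\<mu> t. \<gamma> ^ t *\<^sub>R (\<Sum>z\<in>UNIV. pmf (trajectory_law P \<pi> \<mu> t) z *\<^sub>R f z)"
  have "(\<lambda>t. ?c (return_pmf z) (Suc t)) = (\<lambda>t. \<gamma> *\<^sub>R ?c (sa_step P \<pi> z) t)"
    by (simp add: trajectory_law_Suc_shift bind_return_pmf)
  then have "(\<lambda>t. ?c (return_pmf z) (Suc t)) sums (\<gamma> *\<^sub>R discounted P \<pi> \<gamma> f (sa_step P \<pi> z))"
    by (simp only:) (intro sums_scaleR_right discounted_sums)
  from sums_Suc[OF this] show "?c (return_pmf z) sums (f z + \<gamma> *\<^sub>R discounted P \<pi> \<gamma> f (sa_step P \<pi> z))"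
    by (simp add: sum_pmf_return add.commute)
qed

lemma discounted_return_Bellman:
  "discounted P \<pi> \<gamma> f (return_pmf (s, a)) = f (s, a)
     + \<gamma> *\<^sub>R (\<Sum>s'\<in>UNIV. pmf (P s a) s' *\<^sub>R discounted P \<pi> \<gamma> f (map_pmf (Pair s') (\<pi> s')))"
  by (simp add: discounted_return sa_step_def discounted_bind)

lemma discounted_map_Bellman:
  "discounted P \<pi> \<gamma> f (map_pmf (Pair s) (\<pi> s)) = (\<Sum>a\<in>UNIV. pmf (\<pi> s) a *\<^sub>R (f (s, a)
     + \<gamma> *\<^sub>R (\<Sum>s'\<in>UNIV. pmf (P s a) s' *\<^sub>R discounted P \<pi> \<gamma> f (map_pmf (Pair s') (\<pi> s')))))"
  by (simp add: map_pmf_def[of "Pair s"] discounted_bind discounted_return_Bellman)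

end

section \<open>Averages over a distribution and discounted recursive bounds\<close>

lemma pmf_average_le:
  fixes p :: "'a::finite pmf" and f :: "'a \<Rightarrow> real"
  assumes "\<And>a. f a \<le> B"
  shows "(\<Sum>a\<in>UNIV. pmf p a * f a) \<le> B"
proof -
  have "(\<Sum>a\<in>UNIV. pmf p a * f a) \<le> (\<Sum>a\<in>UNIV. pmf p a * B)"
    by (intro sum_mono mult_left_mono assms) simp
  also have "\<dots> = B"
    by (simp add: sum_distrib_right[symmetric] sum_pmf_eq_1)
  finally show ?thesis .
qed

lemma abs_pmf_average_le:
  fixes p :: "'a::finite pmf" and f :: "'a \<Rightarrow> real"
  assumes "\<And>a. \<bar>f a\<bar> \<le> B"
  shows "\<bar>\<Sum>a\<in>UNIV. pmf p a * f a\<bar> \<le> B"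
proof -
  have "f a \<le> B" "- f a \<le> B" for a
    using assms[of a] by (auto simp: abs_le_iff)
  then have "(\<Sum>a\<in>UNIV. pmf p a * f a) \<le> B" "(\<Sum>a\<in>UNIV. pmf p a * - f a) \<le> B"
    by (simp_all only: pmf_average_le)
  then show ?thesis
    by (simp add: sum_negf abs_le_iff)
qed

text \<open>At a state where \<open>u\<close> is maximal, \<open>step\<close> with \<open>M\<close>
  equal to the maximum bounds the maximum by itself, and \<gamma> < 1 allows solving for it. All
  later comparisons of value functions go through this argument.\<close>

lemma discounted_bound:
  fixes u :: "'s::finite \<Rightarrow> real"
  assumes "\<gamma> < 1" and step: "\<And>s M. (\<And>s'. u s' \<le> M) \<Longrightarrow> u s \<le> c + \<gamma> * M"
  shows "u s \<le> c / (1 - \<gamma>)"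
proof -
  have le: "u s' \<le> Max (range u)" for s'
    by simp
  obtain s0 where s0: "Max (range u) = u s0"
    using Max_in[of "range u"] by (auto simp del: Max_in)
  have "u s0 \<le> c + \<gamma> * u s0"
    using step[OF le] s0 by simp
  then have "u s0 \<le> c / (1 - \<gamma>)"
    using assms(1) by (simp add: field_simps)
  then show ?thesis
    using le[of s] s0 by simp
qed

subsection \<open>The entropy-regularized maximum\<close>

definition log_sum_exp :: "real \<Rightarrow> ('a::finite \<Rightarrow> real) \<Rightarrow> real"
  where "log_sum_exp \<tau> q = \<tau> * ln (\<Sum>a\<in>UNIV. exp (q a / \<tau>))"

definition softmax :: "real \<Rightarrow> ('a::finite \<Rightarrow> real) \<Rightarrow> 'a pmf"
  where "softmax \<tau> q = embed_pmf (\<lambda>a. exp (q a / \<tau>) / (\<Sum>b\<in>UNIV. exp (q b / \<tau>)))"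

lemma sum_exp_pos: "0 < (\<Sum>a\<in>UNIV. exp (q a))" for q :: "'a::finite \<Rightarrow> real"
  by (rule sum_pos) auto

lemma pmf_softmax: "pmf (softmax \<tau> q) a = exp (q a / \<tau>) / (\<Sum>b\<in>UNIV. exp (q b / \<tau>))"
  unfolding softmax_def
proof (rule pmf_embed_pmf)
  let ?S = "\<Sum>b\<in>UNIV. exp (q b / \<tau>)"
  have S: "0 < ?S"
    by (rule sum_exp_pos)
  show "0 \<le> exp (q a / \<tau>) / ?S" for a
    using S by simp
  have "(\<integral>\<^sup>+a. ennreal (exp (q a / \<tau>) / ?S) \<partial>count_space UNIV) = ennreal (\<Sum>a\<in>UNIV. exp (q a / \<tau>) / ?S)"
    using S by (simp add: nn_integral_count_space_finite)
  also have "(\<Sum>a\<in>UNIV. exp (q a / \<tau>) / ?S) = 1"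
    using S by (simp add: sum_divide_distrib[symmetric])
  finally show "(\<integral>\<^sup>+a. ennreal (exp (q a / \<tau>) / ?S) \<partial>count_space UNIV) = 1"
    by simp
qed

lemma pmf_softmax_pos: "0 < pmf (softmax \<tau> q) a"
  by (simp add: pmf_softmax sum_exp_pos)

lemma ln_pmf_softmax:
  assumes "0 < \<tau>"
  shows "\<tau> * ln (pmf (softmax \<tau> q) a) = q a - log_sum_exp \<tau> q"
  using assms sum_exp_pos[of "\<lambda>a. q a / \<tau>"]
  by (simp add: pmf_softmax ln_div log_sum_exp_def right_diff_distrib)

text \<open>The gap is \<open>\<tau>\<close> times the relative entropy of \<open>p\<close> with respect to the softmax. The terms
  \<open>pmf (softmax \<tau> q) a - pmf p a\<close>, which sum to 0, make every summand nonnegative.\<close>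

lemma log_sum_exp_gap:
  assumes "0 < \<tau>"
  shows "log_sum_exp \<tau> q - ((\<Sum>a\<in>UNIV. pmf p a * q a) + \<tau> * policy_entropy p)
    = \<tau> * (\<Sum>a\<in>UNIV. pmf (softmax \<tau> q) a - pmf p a - pmf p a * (ln (pmf (softmax \<tau> q) a) - ln (pmf p a)))"
proof -
  let ?m = "softmax \<tau> q"
  have q: "q a = log_sum_exp \<tau> q + \<tau> * ln (pmf ?m a)" for a
    using ln_pmf_softmax[OF assms, of q a] by simp
  \<comment> \<open>Writing \<open>q\<close> through the logarithm of its softmax turns the linear
    term into a cross entropy, which joins with \<open>policy_entropy p\<close> to form the relative
    entropy.\<close>
  have "(\<Sum>a\<in>UNIV. pmf p a * q a) = (\<Sum>a\<in>UNIV. pmf p a * log_sum_exp \<tau> q + \<tau> * (pmf p a * ln (pmf ?m a)))"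
    by (intro sum.cong refl) (subst q, simp add: algebra_simps)
  also have "\<dots> = log_sum_exp \<tau> q + \<tau> * (\<Sum>a\<in>UNIV. pmf p a * ln (pmf ?m a))"
    by (simp add: sum.distrib sum_distrib_right[symmetric] sum_distrib_left[symmetric] sum_pmf_eq_1)
  finally show ?thesis
    by (simp add: policy_entropy_def sum_subtractf sum_pmf_eq_1 right_diff_distrib)
qed

text \<open>For p > 0 the term is p * (u - 1 - ln u) with u = m / p, and ln u \<le> u - 1 with
  equality only at u = 1. For p = 0 it equals m > 0.\<close>

lemma relative_entropy_term:
  fixes m p :: real
  assumes "0 < m" "0 \<le> p"
  shows "0 \<le> m - p - p * (ln m - ln p)" and "m - p - p * (ln m - ln p) = 0 \<Longrightarrow> p = m"
proof -
  have *: "m - p - p * (ln m - ln p) = p * (m / p - 1 - ln (m / p))" if "0 < p"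
    using assms that by (simp add: ln_div field_simps)
  show "0 \<le> m - p - p * (ln m - ln p)"
  proof (cases "p = 0")
    case False
    then show ?thesis
      using assms * ln_le_minus_one[of "m / p"] by simp
  qed (use assms in simp)
  assume eq: "m - p - p * (ln m - ln p) = 0"
  then have "p \<noteq> 0"
    using assms by auto
  then show "p = m"
    using eq assms * ln_eq_minus_one[of "m / p"] by simp
qed

lemma log_sum_exp_ge:
  assumes "0 < \<tau>"
  shows "(\<Sum>a\<in>UNIV. pmf p a * q a) + \<tau> * policy_entropy p \<le> log_sum_exp \<tau> q"
proof -
  have "0 \<le> log_sum_exp \<tau> q - ((\<Sum>a\<in>UNIV. pmf p a * q a) + \<tau> * policy_entropy p)"
    unfolding log_sum_exp_gap[OF assms] using assms
    by (intro mult_nonneg_nonneg sum_nonneg relative_entropy_term pmf_softmax_pos) auto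
  then show ?thesis
    by simp
qed

text \<open>A sum of nonnegative terms vanishes only if each term does. This equality case yields
  the uniqueness of the optimal policy.\<close>

lemma log_sum_exp_eq_iff:
  assumes "0 < \<tau>"
  shows "(\<Sum>a\<in>UNIV. pmf p a * q a) + \<tau> * policy_entropy p = log_sum_exp \<tau> q \<longleftrightarrow> p = softmax \<tau> q"
proof
  assume "p = softmax \<tau> q"
  then show "(\<Sum>a\<in>UNIV. pmf p a * q a) + \<tau> * policy_entropy p = log_sum_exp \<tau> q"
    using log_sum_exp_gap[OF assms, of q p] by simp
next
  assume "(\<Sum>a\<in>UNIV. pmf p a * q a) + \<tau> * policy_entropy p = log_sum_exp \<tau> q"
  then have "(\<Sum>a\<in>UNIV. pmf (softmax \<tau> q) a - pmf p a - pmf p a * (ln (pmf (softmax \<tau> q) a) - ln (pmf p a))) = 0"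
    using log_sum_exp_gap[OF assms, of q p] assms by simp
  then have "pmf (softmax \<tau> q) a - pmf p a - pmf p a * (ln (pmf (softmax \<tau> q) a) - ln (pmf p a)) = 0" for a
    by (subst (asm) sum_nonneg_eq_0_iff) (auto simp del: diff_ge_0_iff_ge intro: relative_entropy_term pmf_softmax_pos)
  then have "pmf p a = pmf (softmax \<tau> q) a" for a
    by (rule relative_entropy_term(2)[OF pmf_softmax_pos pmf_nonneg])
  then show "p = softmax \<tau> q"
    by (rule pmf_eqI)
qed

text \<open>The maximizer for \<open>q\<close> is used as a competitor in the variational problem
  for \<open>q'\<close>. Monotonicity and equivariance under constant shifts are covered at
  once.\<close>

lemma log_sum_exp_mono:
  assumes "0 < \<tau>" and "\<And>a. q a \<le> q' a + c"
  shows "log_sum_exp \<tau> q \<le> log_sum_exp \<tau> q' + c"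
proof -
  let ?m = "softmax \<tau> q"
  have "(\<Sum>a\<in>UNIV. pmf ?m a * (q a - q' a)) \<le> c"
    by (rule pmf_average_le) (use assms(2) in \<open>simp add: algebra_simps\<close>)
  then have "(\<Sum>a\<in>UNIV. pmf ?m a * q a) \<le> (\<Sum>a\<in>UNIV. pmf ?m a * q' a) + c"
    by (simp add: right_diff_distrib sum_subtractf)
  then show ?thesis
    using log_sum_exp_ge[OF assms(1), of ?m q'] log_sum_exp_eq_iff[OF assms(1), of ?m q] by simp
qed

text \<open>Differentiability of log-sum-exp, with the softmax as gradient, restated with a uniform
  bound on the coordinates so that it combines with sup-norm estimates.\<close>

lemma log_sum_exp_expansion:
  fixes q :: "'a::finite \<Rightarrow> real"
  assumes "0 < \<tau>" "0 < \<epsilon>"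
  obtains \<delta> where "0 < \<delta>"
    and "\<And>q' d. d \<le> \<delta> \<Longrightarrow> (\<And>a. \<bar>q' a - q a\<bar> \<le> d) \<Longrightarrow>
      \<bar>log_sum_exp \<tau> q' - log_sum_exp \<tau> q - (\<Sum>a\<in>UNIV. pmf (softmax \<tau> q) a * (q' a - q a))\<bar> \<le> \<epsilon> * d"
proof -
  let ?n = "real CARD('a)"
  define v where "v = (\<chi> a. q a)"
  have lin: "((\<lambda>w::real^'a. w $ a / \<tau>) has_derivative (\<lambda>h. h $ a / \<tau>)) (at v)" for a
    by (intro bounded_linear_imp_has_derivative bounded_linear_compose[OF bounded_linear_divide bounded_linear_vec_nth])
  have "((\<lambda>w::real^'a. \<tau> * ln (\<Sum>a\<in>UNIV. exp (w $ a / \<tau>))) has_derivative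
      (\<lambda>h. \<tau> * ((\<Sum>a\<in>UNIV. h $ a / \<tau> * exp (v $ a / \<tau>)) * inverse (\<Sum>a\<in>UNIV. exp (v $ a / \<tau>))))) (at v)"
    by (intro has_derivative_mult_right has_derivative_ln has_derivative_sum has_derivative_exp lin sum_exp_pos)
  moreover have "(\<lambda>h. \<tau> * ((\<Sum>a\<in>UNIV. h $ a / \<tau> * exp (v $ a / \<tau>)) * inverse (\<Sum>a\<in>UNIV. exp (v $ a / \<tau>))))
      = (\<lambda>h. \<Sum>a\<in>UNIV. pmf (softmax \<tau> q) a * h $ a)"
    unfolding pmf_softmax v_def sum_distrib_left sum_distrib_right
    using assms(1) by (intro ext sum.cong refl) (simp add: divide_inverse)
  ultimately have "((\<lambda>w::real^'a. log_sum_exp \<tau> (\<lambda>a. w $ a)) has_derivative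
      (\<lambda>h. \<Sum>a\<in>UNIV. pmf (softmax \<tau> q) a * h $ a)) (at v)"
    by (simp add: log_sum_exp_def)
  then obtain \<delta> where \<delta>: "0 < \<delta>" "\<And>w. norm (w - v) < \<delta> \<Longrightarrow>
      norm (log_sum_exp \<tau> (\<lambda>a. w $ a) - log_sum_exp \<tau> (\<lambda>a. v $ a) - (\<Sum>a\<in>UNIV. pmf (softmax \<tau> q) a * (w - v) $ a))
        \<le> (\<epsilon> / ?n) * norm (w - v)"
    unfolding has_derivative_at_alt using assms(2) by (meson divide_pos_pos of_nat_0_less_iff zero_less_card_finite)
  show thesis
  proof
    \<comment> \<open>The Euclidean norm is at most \<open>?n\<close> times the largest coordinate;
      this accounts for \<open>?n\<close> here and in \<open>\<epsilon> / ?n\<close>. The factor 2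
      makes the inequality strict.\<close>
    show "0 < \<delta> / (2 * ?n)"
      using \<delta>(1) by simp
    fix q' d assume d: "d \<le> \<delta> / (2 * ?n)" "\<And>a. \<bar>q' a - q a\<bar> \<le> d"
    define w where "w = (\<chi> a. q' a)"
    have "norm (w - v) \<le> (\<Sum>a\<in>UNIV. \<bar>(w - v) $ a\<bar>)"
      by (rule norm_le_l1_cart)
    also have "\<dots> \<le> (\<Sum>a\<in>(UNIV::'a set). d)"
      by (rule sum_mono) (use d in \<open>simp add: w_def v_def\<close>)
    finally have n: "norm (w - v) \<le> ?n * d"
      by simp
    also have "\<dots> \<le> \<delta> / 2"
      using d(1) by (simp add: field_simps)
    also have "\<dots> < \<delta>"
      using \<delta>(1) by simp
    finally have "\<bar>log_sum_exp \<tau> q' - log_sum_exp \<tau> q - (\<Sum>a\<in>UNIV. pmf (softmax \<tau> q) a * (q' a - q a))\<bar>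
        \<le> (\<epsilon> / ?n) * norm (w - v)"
      using \<delta>(2)[of w] by (simp add: w_def v_def)
    also have "\<dots> \<le> (\<epsilon> / ?n) * (?n * d)"
      using n assms(2) by (intro mult_left_mono) auto
    finally show "\<bar>log_sum_exp \<tau> q' - log_sum_exp \<tau> q - (\<Sum>a\<in>UNIV. pmf (softmax \<tau> q) a * (q' a - q a))\<bar> \<le> \<epsilon> * d"
      by simp
  qed
qed

subsection \<open>The soft Bellman equation\<close>

text \<open>The formula of \<open>q_fn\<close> with the value function left free, so that it applies
  to candidate solutions of the soft Bellman equation.\<close>

definition q_backup ::
  "('s::finite \<Rightarrow> 'a::finite \<Rightarrow> 's pmf) \<Rightarrow> real \<Rightarrow> ('s \<Rightarrow> 'a \<Rightarrow> real) \<Rightarrow> ('s \<Rightarrow> real) \<Rightarrow> 's \<Rightarrow> 'a \<Rightarrow> real"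
  where "q_backup P \<gamma> r V s a = r s a + \<gamma> * (\<Sum>s'\<in>UNIV. pmf (P s a) s' * V s')"

lemma q_fn_eq_q_backup: "q_fn P \<gamma> \<tau> r \<pi> = q_backup P \<gamma> r (value_fn P \<gamma> \<tau> r \<pi>)"
  by (simp add: fun_eq_iff q_fn_def q_backup_def)

lemma q_backup_mono:
  assumes "0 \<le> \<gamma>" "\<And>s'. V s' \<le> V' s' + M" "r s a \<le> r' s a + b"
  shows "q_backup P \<gamma> r V s a \<le> q_backup P \<gamma> r' V' s a + (b + \<gamma> * M)"
proof -
  have "(\<Sum>s'\<in>UNIV. pmf (P s a) s' * (V s' - V' s')) \<le> M"
    by (rule pmf_average_le) (use assms(2) in \<open>simp add: algebra_simps\<close>)
  then have "\<gamma> * (\<Sum>s'\<in>UNIV. pmf (P s a) s' * V s') \<le> \<gamma> * ((\<Sum>s'\<in>UNIV. pmf (P s a) s' * V' s') + M)"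
    by (intro mult_left_mono assms(1)) (simp add: right_diff_distrib sum_subtractf)
  then show ?thesis
    using assms(3) by (simp add: q_backup_def algebra_simps)
qed

text \<open>The entropy bonus depends on the state alone, so averaging over actions leaves it
  unchanged.\<close>

lemma value_fn_Bellman:
  assumes "0 \<le> \<gamma>" "\<gamma> < 1"
  shows "value_fn P \<gamma> \<tau> r \<pi> s =
    (\<Sum>a\<in>UNIV. pmf (\<pi> s) a * q_backup P \<gamma> r (value_fn P \<gamma> \<tau> r \<pi>) s a) + \<tau> * policy_entropy (\<pi> s)"
proof -
  let ?f = "\<lambda>z. r (fst z) (snd z) + \<tau> * policy_entropy (\<pi> (fst z))"
  have v: "value_fn P \<gamma> \<tau> r \<pi> s = discounted P \<pi> \<gamma> ?f (map_pmf (Pair s) (\<pi> s))" for s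
    by (simp add: value_fn_def discounted_def)
  have "value_fn P \<gamma> \<tau> r \<pi> s = (\<Sum>a\<in>UNIV. pmf (\<pi> s) a * q_backup P \<gamma> r (value_fn P \<gamma> \<tau> r \<pi>) s a
      + pmf (\<pi> s) a * (\<tau> * policy_entropy (\<pi> s)))"
    unfolding v[of s] discounted_map_Bellman[OF assms, of P \<pi> ?f s]
    by (simp add: q_backup_def v[symmetric] algebra_simps)
  then show ?thesis
    by (simp add: sum.distrib sum_distrib_right[symmetric] sum_pmf_eq_1)
qed

text \<open>The soft Bellman operator contracts the supremum norm, but not the Euclidean norm carried by
  \<open>real ^ 's\<close>; existence is therefore obtained from Brouwer's theorem on an invariant box.\<close>

lemma soft_Bellman_fixed_point:
  fixes P :: "'s::finite \<Rightarrow> 'a::finite \<Rightarrow> 's pmf"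
  assumes "0 \<le> \<gamma>" "\<gamma> < 1" "0 < \<tau>"
  obtains W where "\<And>s. W s = log_sum_exp \<tau> (q_backup P \<gamma> r W s)"
proof -
  define T where "T v = (\<chi> s. log_sum_exp \<tau> (q_backup P \<gamma> r (\<lambda>s'. v $ s') s))" for v :: "real ^ 's"
  define B where "B = Max (range (\<lambda>s. \<bar>T 0 $ s\<bar>))"
  \<comment> \<open>The radius solves \<open>B + \<gamma> * R = R\<close>: moving \<open>v\<close>
    away from 0 within the box changes \<open>T v\<close> by at most \<gamma> R, so the box is
    mapped into itself.\<close>
  define R where "R = B / (1 - \<gamma>)"
  have B: "\<bar>T 0 $ s\<bar> \<le> B" for s
    by (simp add: B_def)
  have R: "B + \<gamma> * R = R"
    using assms by (simp add: R_def field_simps)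
  have "0 \<le> R"
    using B[of undefined] assms by (simp add: R_def)
  let ?K = "cbox (\<chi> s. - R) (\<chi> s. R) :: (real ^ 's) set"
  have bound: "\<bar>T v $ s\<bar> \<le> R" if "v \<in> ?K" for v s
  proof -
    have v: "0 \<le> v $ s' + R" "v $ s' \<le> R" for s'
      using that by (auto simp: mem_box_cart dest: spec[of _ s'])
    have "q_backup P \<gamma> r (\<lambda>s'. v $ s') s a \<le> q_backup P \<gamma> r (\<lambda>s'. 0 $ s') s a + (0 + \<gamma> * R)"
      and "q_backup P \<gamma> r (\<lambda>s'. 0 $ s') s a \<le> q_backup P \<gamma> r (\<lambda>s'. v $ s') s a + (0 + \<gamma> * R)" for a
      by (rule q_backup_mono; use assms(1) v in simp)+
    then have "T v $ s \<le> T 0 $ s + (0 + \<gamma> * R)" "T 0 $ s \<le> T v $ s + (0 + \<gamma> * R)"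
      unfolding T_def vec_lambda_beta by (simp_all only: log_sum_exp_mono[OF assms(3)])
    then show ?thesis
      using B[of s] R by linarith
  qed
  have "continuous_on ?K T"
    unfolding T_def log_sum_exp_def q_backup_def
    by (intro continuous_intros ballI) (use assms(3) sum_exp_pos[THEN less_imp_neq, THEN not_sym] in simp_all)
  moreover have "T \<in> ?K \<rightarrow> ?K"
  proof
    fix v assume "v \<in> ?K"
    from bound[OF this] show "T v \<in> ?K"
      by (auto simp: mem_box_cart abs_le_iff minus_le_iff)
  qed
  moreover have "?K \<noteq> {}"
    using \<open>0 \<le> R\<close> by (simp add: interval_ne_empty_cart)
  ultimately obtain v where "T v = v"
    using brouwer[OF compact_cbox convex_box(1), of "\<chi> s. - R" "\<chi> s. R" T] by blast
  then have "v $ s = log_sum_exp \<tau> (q_backup P \<gamma> r (\<lambda>s'. v $ s') s)" for s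
    unfolding T_def by (metis vec_lambda_beta)
  then show thesis
    by (rule that)
qed

section \<open>Any solution of the soft Bellman equation is the optimal value\<close>

context
  fixes P :: "'s::finite \<Rightarrow> 'a::finite \<Rightarrow> 's pmf" and \<gamma> \<tau> :: real and r :: "'s \<Rightarrow> 'a \<Rightarrow> real"
    and W :: "'s \<Rightarrow> real"
  assumes gamma: "0 \<le> \<gamma>" "\<gamma> < 1" and tau: "0 < \<tau>"
    and W: "\<And>s. W s = log_sum_exp \<tau> (q_backup P \<gamma> r W s)"
begin

text \<open>The value of a policy is a subsolution of the soft Bellman equation by the Gibbs
  inequality, and its excess over \<open>W\<close> shrinks by \<gamma> at each step.\<close>

lemma value_fn_le_fixed_point: "value_fn P \<gamma> \<tau> r \<pi> s \<le> W s"
proof -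
  let ?V = "value_fn P \<gamma> \<tau> r \<pi>"
  have "?V s - W s \<le> 0 / (1 - \<gamma>)"
  proof (rule discounted_bound[OF gamma(2)])
    fix s M assume "\<And>s'. ?V s' - W s' \<le> M"
    then have "q_backup P \<gamma> r ?V s a \<le> q_backup P \<gamma> r W s a + (0 + \<gamma> * M)" for a
      by (intro q_backup_mono gamma(1)) (auto simp: algebra_simps)
    then have "log_sum_exp \<tau> (q_backup P \<gamma> r ?V s) \<le> W s + (0 + \<gamma> * M)"
      unfolding W[of s] by (rule log_sum_exp_mono[OF tau])
    moreover have "?V s \<le> log_sum_exp \<tau> (q_backup P \<gamma> r ?V s)"
      by (subst value_fn_Bellman[OF gamma]) (rule log_sum_exp_ge[OF tau])
    ultimately show "?V s - W s \<le> 0 + \<gamma> * M"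
      by linarith
  qed
  then show ?thesis
    by simp
qed

text \<open>The softmax attains equality in the Gibbs inequality, so \<open>W\<close> solves the
  linear Bellman equation of this policy.\<close>

lemma value_fn_softmax_fixed_point:
  "value_fn P \<gamma> \<tau> r (\<lambda>s. softmax \<tau> (q_backup P \<gamma> r W s)) s = W s"
proof -
  let ?\<pi> = "\<lambda>s. softmax \<tau> (q_backup P \<gamma> r W s)"
  let ?V = "value_fn P \<gamma> \<tau> r ?\<pi>"
  have W': "W s = (\<Sum>a\<in>UNIV. pmf (?\<pi> s) a * q_backup P \<gamma> r W s a) + \<tau> * policy_entropy (?\<pi> s)" for s
    using log_sum_exp_eq_iff[OF tau, of "?\<pi> s" "q_backup P \<gamma> r W s"] W[of s] by simp
  have "W s - ?V s \<le> 0 / (1 - \<gamma>)"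
  proof (rule discounted_bound[OF gamma(2)])
    fix s M assume "\<And>s'. W s' - ?V s' \<le> M"
    then have "q_backup P \<gamma> r W s a \<le> q_backup P \<gamma> r ?V s a + (0 + \<gamma> * M)" for a
      by (intro q_backup_mono gamma(1)) (auto simp: algebra_simps)
    then have "(\<Sum>a\<in>UNIV. pmf (?\<pi> s) a * (q_backup P \<gamma> r W s a - q_backup P \<gamma> r ?V s a)) \<le> 0 + \<gamma> * M"
      by (intro pmf_average_le) (simp add: algebra_simps)
    then show "W s - ?V s \<le> 0 + \<gamma> * M"
      using W'[of s] value_fn_Bellman[OF gamma, of P \<tau> r ?\<pi> s]
      by (simp add: right_diff_distrib sum_subtractf)
  qed
  then show ?thesis
    using value_fn_le_fixed_point[of ?\<pi> s] by simp
qed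

text \<open>For another maximizer the gaps to \<open>W\<close>, weighted by \<rho>, are nonnegative
  with nonpositive sum. Positivity of \<rho> forces the value to be \<open>W\<close> in every
  state.\<close>

lemma optimal_policy_eq_softmax:
  assumes rho: "\<And>s. 0 < pmf \<rho> s"
  shows "optimal_policy P \<gamma> \<tau> \<rho> r = (\<lambda>s. softmax \<tau> (q_backup P \<gamma> r W s))"
  unfolding optimal_policy_def
proof (rule the_equality)
  let ?\<pi> = "\<lambda>s. softmax \<tau> (q_backup P \<gamma> r W s)"
  let ?J = "\<lambda>\<pi>. \<Sum>s\<in>UNIV. pmf \<rho> s * value_fn P \<gamma> \<tau> r \<pi> s"
  have J: "?J ?\<pi> = (\<Sum>s\<in>UNIV. pmf \<rho> s * W s)"
    by (simp add: value_fn_softmax_fixed_point)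
  have "?J \<pi> \<le> ?J ?\<pi>" for \<pi>
    unfolding J by (intro sum_mono mult_left_mono value_fn_le_fixed_point) simp
  then show "is_arg_max ?J (\<lambda>_. True) ?\<pi>"
    by (simp add: is_arg_max_linorder)
  fix \<pi> assume "is_arg_max ?J (\<lambda>_. True) \<pi>"
  then have "?J ?\<pi> \<le> ?J \<pi>"
    by (simp add: is_arg_max_linorder)
  then have "(\<Sum>s\<in>UNIV. pmf \<rho> s * (W s - value_fn P \<gamma> \<tau> r \<pi> s)) \<le> 0"
    unfolding J by (simp add: right_diff_distrib sum_subtractf)
  moreover have nonneg: "0 \<le> pmf \<rho> s * (W s - value_fn P \<gamma> \<tau> r \<pi> s)" for s
    using value_fn_le_fixed_point[of \<pi> s] by simp
  ultimately have "(\<Sum>s\<in>UNIV. pmf \<rho> s * (W s - value_fn P \<gamma> \<tau> r \<pi> s)) = 0"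
    by (intro antisym sum_nonneg)
  then have "pmf \<rho> s * (W s - value_fn P \<gamma> \<tau> r \<pi> s) = 0" for s
    using nonneg by (subst (asm) sum_nonneg_eq_0_iff) auto
  then have V: "value_fn P \<gamma> \<tau> r \<pi> = W"
    using rho by (auto simp: fun_eq_iff less_le)
  show "\<pi> = ?\<pi>"
  proof
    fix s
    show "\<pi> s = ?\<pi> s"
      \<comment> \<open>With value \<open>W\<close>, the Bellman equation of \<pi> becomes the
        equality case of the Gibbs inequality.\<close>
      using value_fn_Bellman[OF gamma, of P \<tau> r \<pi> s] W[of s]
      unfolding V log_sum_exp_eq_iff[OF tau, symmetric] by simp
  qed
qed

end

lemma optimal_soft_Bellman:
  assumes "0 \<le> \<gamma>" "\<gamma> < 1" "0 < \<tau>" "\<And>s. 0 < pmf \<rho> s"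
  shows "optimal_value P \<gamma> \<tau> \<rho> r s = log_sum_exp \<tau> (optimal_q P \<gamma> \<tau> \<rho> r s)"
    and "optimal_policy P \<gamma> \<tau> \<rho> r s = softmax \<tau> (optimal_q P \<gamma> \<tau> \<rho> r s)"
proof -
  obtain W where W: "\<And>s. W s = log_sum_exp \<tau> (q_backup P \<gamma> r W s)"
    using soft_Bellman_fixed_point[OF assms(1-3)] by blast
  note policy = optimal_policy_eq_softmax[OF assms(1-3) W assms(4)]
  have V: "optimal_value P \<gamma> \<tau> \<rho> r = W"
    by (rule ext) (simp add: optimal_value_def policy value_fn_softmax_fixed_point[OF assms(1-3) W])
  have Q: "optimal_q P \<gamma> \<tau> \<rho> r = q_backup P \<gamma> r W"
    using V by (simp add: optimal_q_def optimal_value_def q_fn_eq_q_backup)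
  show "optimal_value P \<gamma> \<tau> \<rho> r s = log_sum_exp \<tau> (optimal_q P \<gamma> \<tau> \<rho> r s)"
    unfolding V Q by (rule W)
  show "optimal_policy P \<gamma> \<tau> \<rho> r s = softmax \<tau> (optimal_q P \<gamma> \<tau> \<rho> r s)"
    unfolding policy Q ..
qed

lemma optimal_q_eq_q_backup: "optimal_q P \<gamma> \<tau> \<rho> r = q_backup P \<gamma> r (optimal_value P \<gamma> \<tau> \<rho> r)"
  by (simp add: optimal_q_def optimal_value_def q_fn_eq_q_backup)

subsection \<open>Differentiability of the optimal values\<close>

context
  fixes P :: "'s::finite \<Rightarrow> 'a::finite \<Rightarrow> 's pmf" and \<gamma> \<tau> :: real and \<rho> :: "'s pmf"
  assumes gamma: "0 \<le> \<gamma>" "\<gamma> < 1" and tau: "0 < \<tau>" and rho: "\<And>s. 0 < pmf \<rho> s"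
begin

lemma optimal_q_le:
  fixes r r' :: "'s \<Rightarrow> 'a \<Rightarrow> real"
  assumes b: "\<And>s a. r s a \<le> r' s a + b"
  shows "optimal_q P \<gamma> \<tau> \<rho> r s a \<le> optimal_q P \<gamma> \<tau> \<rho> r' s a + b / (1 - \<gamma>)"
proof -
  let ?V = "optimal_value P \<gamma> \<tau> \<rho>" and ?Q = "optimal_q P \<gamma> \<tau> \<rho>"
  have q: "?Q r s a \<le> ?Q r' s a + (b + \<gamma> * M)" if "\<And>s. ?V r s - ?V r' s \<le> M" for s a M
  proof -
    have "?V r s \<le> ?V r' s + M" for s
      using that[of s] by simp
    then show ?thesis
      unfolding optimal_q_eq_q_backup by (rule q_backup_mono[OF gamma(1) _ b])
  qed
  have v: "?V r s - ?V r' s \<le> b / (1 - \<gamma>)" for s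
  proof (rule discounted_bound[OF gamma(2)])
    fix s M assume "\<And>s. ?V r s - ?V r' s \<le> M"
    from log_sum_exp_mono[OF tau q[OF this]]
    show "?V r s - ?V r' s \<le> b + \<gamma> * M"
      by (simp add: optimal_soft_Bellman(1)[OF gamma tau rho] algebra_simps)
  qed
  \<comment> \<open>The bound on the values is reproduced by one more backup, so it also holds for
    Q.\<close>
  have "b + \<gamma> * (b / (1 - \<gamma>)) = b / (1 - \<gamma>)"
    using gamma by (simp add: field_simps)
  then show "?Q r s a \<le> ?Q r' s a + b / (1 - \<gamma>)"
    using q[OF v, of s a] by simp
qed

text \<open>This gives a change in Q of order \<open>norm (y - x)\<close> before any
  differentiability is known, as required for the log-sum-exp remainder to be of smaller
  order.\<close>

lemma optimal_q_Lipschitz: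
  fixes r r' :: "'s \<Rightarrow> 'a \<Rightarrow> real"
  assumes b: "\<And>s a. \<bar>r s a - r' s a\<bar> \<le> b"
  shows "\<bar>optimal_q P \<gamma> \<tau> \<rho> r s a - optimal_q P \<gamma> \<tau> \<rho> r' s a\<bar> \<le> b / (1 - \<gamma>)"
proof -
  have "r s a \<le> r' s a + b" "r' s a \<le> r s a + b" for s a
    using b[of s a] by (auto simp: abs_le_iff algebra_simps)
  then show ?thesis
    using optimal_q_le[of r r' b s a] optimal_q_le[of r' r b s a] by (simp add: abs_le_iff algebra_simps)
qed

text \<open>The candidate gradient \<open>D\<close> enters only through its linear Bellman equation;
  the stability of that equation yields differentiability directly.\<close>

lemma GDERIV_optimal_value:
  fixes r :: "'e::euclidean_space \<Rightarrow> 's \<Rightarrow> 'a \<Rightarrow> real" and g :: "'s \<Rightarrow> 'a \<Rightarrow> 'e" and D :: "'s \<Rightarrow> 'e"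
  assumes gradient: "\<And>s a. GDERIV (\<lambda>y. r y s a) x :> g s a"
    and D: "\<And>s. D s = (\<Sum>a\<in>UNIV. pmf (optimal_policy P \<gamma> \<tau> \<rho> (r x) s) a *\<^sub>R
      (g s a + \<gamma> *\<^sub>R (\<Sum>s'\<in>UNIV. pmf (P s a) s' *\<^sub>R D s')))"
  shows "GDERIV (\<lambda>y. optimal_value P \<gamma> \<tau> \<rho> (r y) s) x :> D s"
proof -
  let ?V = "\<lambda>y. optimal_value P \<gamma> \<tau> \<rho> (r y)" and ?Q = "\<lambda>y. optimal_q P \<gamma> \<tau> \<rho> (r y)"
  let ?m = "\<lambda>s a. pmf (optimal_policy P \<gamma> \<tau> \<rho> (r x) s) a"
  \<comment> \<open>A local Lipschitz constant for all reward components: the summand 1 absorbs the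
    first-order error, as \<eta> \<le> 1.\<close>
  define L where "L = 1 + (\<Sum>(s, a)\<in>UNIV. norm (g s a))"
  have g_le: "1 + norm (g s a) \<le> L" for s a
    using member_le_sum[of "(s, a)" UNIV "\<lambda>(s, a). norm (g s a)"] by (auto simp: L_def)
  have "0 < L"
    using g_le[of undefined undefined] norm_ge_zero[of "g undefined undefined"] by linarith
  define K where "K = L / (1 - \<gamma>)"
  have "0 < K"
    using \<open>0 < L\<close> gamma by (simp add: K_def)
  \<comment> \<open>The error \<open>?e\<close> of the linear approximation satisfies \<open>\<bar>?e s\<bar> \<le> 2 * \<eta> * norm (y - x) + \<gamma> * (MAX s'. \<bar>?e s'\<bar>)\<close>.\<close>
  have remainder: "\<exists>d>0. \<forall>y. norm (y - x) < d \<longrightarrow> \<bar>?V y s - ?V x s - inner (y - x) (D s)\<bar> \<le> \<epsilon> * norm (y - x)"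
    if "0 < \<epsilon>" for \<epsilon>
  proof -
    \<comment> \<open>Two errors, from the reward and from log-sum-exp, each contribute \<eta> and
      are amplified by 1 / (1 - \<gamma>); hence the factor (1 - \<gamma>) / 2.\<close>
    define \<eta> where "\<eta> = min 1 (\<epsilon> * (1 - \<gamma>) / 2)"
    have "0 < \<eta>"
      using that gamma by (simp add: \<eta>_def)
    have ev_r: "\<forall>\<^sub>F y in nhds x. \<forall>s a. \<bar>r y s a - r x s a - inner (y - x) (g s a)\<bar> \<le> \<eta> * norm (y - x)"
    proof (intro eventually_all_finite)
      fix s a
      show "\<forall>\<^sub>F y in nhds x. \<bar>r y s a - r x s a - inner (y - x) (g s a)\<bar> \<le> \<eta> * norm (y - x)"
        using gradient[of s a] \<open>0 < \<eta>\<close>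
        unfolding gderiv_def has_derivative_at_alt eventually_nhds_metric dist_norm real_norm_def by blast
    qed
    have ev_lse: "\<forall>\<^sub>F y in nhds x. \<forall>s. (\<forall>a. \<bar>?Q y s a - ?Q x s a\<bar> \<le> K * norm (y - x)) \<longrightarrow>
        \<bar>?V y s - ?V x s - (\<Sum>a\<in>UNIV. ?m s a * (?Q y s a - ?Q x s a))\<bar> \<le> \<eta> * norm (y - x)"
    proof (rule eventually_all_finite)
      fix s
      have "0 < \<eta> / K"
        using \<open>0 < \<eta>\<close> \<open>0 < K\<close> by simp
      then obtain \<delta> where \<delta>: "0 < \<delta>" and exp: "\<And>q' d. d \<le> \<delta> \<Longrightarrow> (\<And>a. \<bar>q' a - ?Q x s a\<bar> \<le> d) \<Longrightarrow>
          \<bar>log_sum_exp \<tau> q' - log_sum_exp \<tau> (?Q x s)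
            - (\<Sum>a\<in>UNIV. pmf (softmax \<tau> (?Q x s)) a * (q' a - ?Q x s a))\<bar> \<le> \<eta> / K * d"
        by (rule log_sum_exp_expansion[OF tau, where q = "?Q x s"]) (rule that; blast)
      \<comment> \<open>The expansion is applied with \<open>d = K * norm (y - x)\<close>, so that
        the error \<open>\<eta> / K * d\<close> becomes
        \<open>\<eta> * norm (y - x)\<close>.\<close>
      have "\<forall>\<^sub>F y in nhds x. norm (y - x) < \<delta> / K"
        unfolding eventually_nhds_metric dist_norm using \<delta> \<open>0 < K\<close> by (intro exI[of _ "\<delta> / K"]) auto
      then show "\<forall>\<^sub>F y in nhds x. (\<forall>a. \<bar>?Q y s a - ?Q x s a\<bar> \<le> K * norm (y - x)) \<longrightarrow>
        \<bar>?V y s - ?V x s - (\<Sum>a\<in>UNIV. ?m s a * (?Q y s a - ?Q x s a))\<bar> \<le> \<eta> * norm (y - x)"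
      proof eventually_elim
        case (elim y)
        then have "K * norm (y - x) \<le> \<delta>"
          using \<open>0 < K\<close> by (simp add: field_simps)
        from exp[OF this, of "?Q y s"] show ?case
          using \<open>0 < K\<close> by (simp add: optimal_soft_Bellman[OF gamma tau rho])
      qed
    qed
    have "\<forall>\<^sub>F y in nhds x. \<bar>?V y s - ?V x s - inner (y - x) (D s)\<bar> \<le> \<epsilon> * norm (y - x)"
      using ev_r ev_lse
    proof eventually_elim
      case (elim y)
      let ?h = "y - x"
      let ?e = "\<lambda>s. ?V y s - ?V x s - inner ?h (D s)"
      have "\<bar>r y s a - r x s a\<bar> \<le> L * norm ?h" for s a
      proof -
        have "\<bar>r y s a - r x s a\<bar> \<le> \<eta> * norm ?h + \<bar>inner ?h (g s a)\<bar>"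
          using elim(1)[rule_format, of s a] by linarith
        also have "\<dots> \<le> 1 * norm ?h + norm ?h * norm (g s a)"
          by (intro add_mono mult_right_mono Cauchy_Schwarz_ineq2) (auto simp: \<eta>_def)
        also have "\<dots> = (1 + norm (g s a)) * norm ?h"
          by (simp add: algebra_simps)
        also have "\<dots> \<le> L * norm ?h"
          by (intro mult_right_mono g_le) simp
        finally show ?thesis .
      qed
      from optimal_q_Lipschitz[OF this]
      have "\<bar>?Q y s a - ?Q x s a\<bar> \<le> K * norm ?h" for s a
        by (simp add: K_def)
      with elim(2) have lse: "\<bar>?V y s - ?V x s - (\<Sum>a\<in>UNIV. ?m s a * (?Q y s a - ?Q x s a))\<bar> \<le> \<eta> * norm ?h" for s
        by blast
      \<comment> \<open>Subtracting the linear Bellman equation of \<open>D\<close> leaves the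
        reward remainder and the same error \<open>?e\<close> at the successor states.\<close>
      have linear: "(\<Sum>a\<in>UNIV. ?m s a * (?Q y s a - ?Q x s a)) - inner ?h (D s) =
          (\<Sum>a\<in>UNIV. ?m s a * ((r y s a - r x s a - inner ?h (g s a)) + \<gamma> * (\<Sum>s'\<in>UNIV. pmf (P s a) s' * ?e s')))" for s
      proof -
        have "inner ?h (D s) = (\<Sum>a\<in>UNIV. ?m s a * (inner ?h (g s a) + \<gamma> * (\<Sum>s'\<in>UNIV. pmf (P s a) s' * inner ?h (D s'))))"
          by (subst D) (simp only: inner_sum_right inner_scaleR_right inner_add_right)
        then show ?thesis
          by (simp add: optimal_q_eq_q_backup q_backup_def sum_subtractf[symmetric] right_diff_distrib[symmetric])
             (simp add: algebra_simps sum_subtractf sum.distrib)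
      qed
      have "\<bar>?e s\<bar> \<le> (2 * \<eta> * norm ?h) / (1 - \<gamma>)"
      proof (rule discounted_bound[OF gamma(2)])
        fix s M assume M: "\<And>s'. \<bar>?e s'\<bar> \<le> M"
        have "\<bar>(\<Sum>a\<in>UNIV. ?m s a * (?Q y s a - ?Q x s a)) - inner ?h (D s)\<bar> \<le> \<eta> * norm ?h + \<gamma> * M"
          unfolding linear
        proof (rule abs_pmf_average_le)
          fix a
          have "\<bar>\<gamma> * (\<Sum>s'\<in>UNIV. pmf (P s a) s' * ?e s')\<bar> \<le> \<gamma> * M"
            using abs_pmf_average_le[OF M, of "P s a"] gamma by (simp add: abs_mult mult_left_mono)
          then show "\<bar>(r y s a - r x s a - inner ?h (g s a)) + \<gamma> * (\<Sum>s'\<in>UNIV. pmf (P s a) s' * ?e s')\<bar> \<le> \<eta> * norm ?h + \<gamma> * M"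
            using elim(1)[rule_format, of s a] by linarith
        qed
        with lse[of s] show "\<bar>?e s\<bar> \<le> 2 * \<eta> * norm ?h + \<gamma> * M"
          by linarith
      qed
      also have "\<dots> \<le> (2 * (\<epsilon> * (1 - \<gamma>) / 2) * norm ?h) / (1 - \<gamma>)"
        using gamma by (intro divide_right_mono mult_right_mono mult_left_mono) (auto simp: \<eta>_def)
      also have "\<dots> = \<epsilon> * norm ?h"
        using gamma by simp
      finally show ?case .
    qed
    then show ?thesis
      by (simp add: eventually_nhds_metric dist_norm)
  qed
  show ?thesis
    unfolding gderiv_def has_derivative_at_alt
    using remainder by (simp add: bounded_linear_inner_left)
qed

lemma GDERIV_optimal_q:
  fixes r :: "'e::euclidean_space \<Rightarrow> 's \<Rightarrow> 'a \<Rightarrow> real" and g :: "'e" and D :: "'s \<Rightarrow> 'e"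
  assumes "GDERIV (\<lambda>y. r y s a) x :> g"
    and "\<And>s. GDERIV (\<lambda>y. optimal_value P \<gamma> \<tau> \<rho> (r y) s) x :> D s"
  shows "GDERIV (\<lambda>y. optimal_q P \<gamma> \<tau> \<rho> (r y) s a) x :> g + \<gamma> *\<^sub>R (\<Sum>s'\<in>UNIV. pmf (P s a) s' *\<^sub>R D s')"
  using assms unfolding optimal_q_eq_q_backup q_backup_def gderiv_def
    inner_add_right inner_scaleR_right inner_sum_right
  by (intro has_derivative_add has_derivative_mult_right has_derivative_sum)

end

section \<open>The gradients as expected discounted sums\<close>

theorem proposition5p1:
  fixes P :: "'s::finite \<Rightarrow> 'a::finite \<Rightarrow> 's pmf"
    and \<gamma> \<tau> :: real
    and \<rho> :: "'s pmf"
    and r :: "real ^ 'n \<Rightarrow> 's \<Rightarrow> 'a \<Rightarrow> real"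
    and grad_r :: "real ^ 'n \<Rightarrow> 's \<Rightarrow> 'a \<Rightarrow> real ^ 'n"
    and x :: "real ^ 'n" and s :: 's and a :: 'a
  assumes gamma: "0 < \<gamma>" "\<gamma> < 1"
    and tau: "0 < \<tau>"
    and rho: "\<And>s. 0 < pmf \<rho> s"
    and gradient: "\<And>s a y. GDERIV (\<lambda>y. r y s a) y :> grad_r y s a"
    and continuous_gradient: "\<And>s a. continuous_on UNIV (\<lambda>y. grad_r y s a)"
  shows "GDERIV (\<lambda>y. optimal_value P \<gamma> \<tau> \<rho> (r y) s) x :>
      (\<integral>\<omega>. (\<Sum>t. \<gamma> ^ t *\<^sub>R grad_r x (fst (\<omega> t)) (snd (\<omega> t)))
        \<partial>trajectory P (optimal_policy P \<gamma> \<tau> \<rho> (r x))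
            (map_pmf (\<lambda>a. (s, a)) (optimal_policy P \<gamma> \<tau> \<rho> (r x) s)))
    \<and> GDERIV (\<lambda>y. optimal_q P \<gamma> \<tau> \<rho> (r y) s a) x :>
      (\<integral>\<omega>. (\<Sum>t. \<gamma> ^ t *\<^sub>R grad_r x (fst (\<omega> t)) (snd (\<omega> t)))
        \<partial>trajectory P (optimal_policy P \<gamma> \<tau> \<rho> (r x)) (return_pmf (s, a)))"
proof -
  let ?\<pi> = "optimal_policy P \<gamma> \<tau> \<rho> (r x)"
  let ?f = "\<lambda>z. grad_r x (fst z) (snd z)"
  let ?D = "\<lambda>s. discounted P ?\<pi> \<gamma> ?f (map_pmf (Pair s) (?\<pi> s))"
  have gamma': "0 \<le> \<gamma>"
    using gamma by simp
  \<comment> \<open>The expected discounted sum of reward gradients satisfies the linear equation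
    demanded of \<open>D\<close> in \<open>GDERIV_optimal_value\<close>.\<close>
  note Bellman = discounted_map_Bellman[OF gamma' gamma(2), of P ?\<pi> ?f, unfolded fst_conv snd_conv]
  have deriv: "GDERIV (\<lambda>y. optimal_value P \<gamma> \<tau> \<rho> (r y) s) x :> ?D s" for s
    by (rule GDERIV_optimal_value[OF gamma' gamma(2) tau rho gradient Bellman])
  have "GDERIV (\<lambda>y. optimal_q P \<gamma> \<tau> \<rho> (r y) s a) x :> discounted P ?\<pi> \<gamma> ?f (return_pmf (s, a))"
    using GDERIV_optimal_q[OF gamma' gamma(2) tau rho gradient deriv, of s a]
    by (simp add: discounted_return_Bellman[OF gamma' gamma(2)])
  with deriv[of s] show ?thesis
    unfolding discounted_def by blast
qed

end
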